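(* If $X$ is a metric space then the uniform space $\mathcal E(X)$ (the space of ends of $X$) is totally bounded and separating (i.e. the intersection of all entourages of its uniformity is the diagonal).
   Context: Metrics are finite-valued. Let $(X,d)$ be a metric space. A subset $E\subseteq X\times X$ is an entourage of $X$ if $\sup_{(x,y)\in E}d(x,y)<\infty$; $B\subseteq X$ is bounded if $B\times B$ is an entourage. A subset $C\subseteq X\times X$ is a coentourage if every sequence $(x_i,y_i)_i$ in $C$ is either bounded (both $(x_i)_i$ and $(y_i)_i$ are bounded) or the set of values $d(x_i,y_i)$ is unbounded; equivalently, for every entourage $E$ there is a bounded set $B$ with $E\cap C\subseteq B\times B$. For an entourage $E$ and $A\subseteq X$ put $E[A]=\{x\in X:\exists a\in A,\ (x,a)\in E\}$. Two subsets $A,B\subseteq X$ are close if $A\times B$ is not a coentourage. A map $f:X\to Y$ of metric spaces is coarse if $(f\times f)(E)$ is an entourage of $Y$ for every entourage $E$ of $X$, and $f^{-1}(B)$ is bounded for every bounded $B\subseteq Y$. A coarse cover of $X$ is a finite family $\mathcal U=(U_i)_i$ of subsets of $X$ such that $(X\times X)\setminus\bigcup_i (U_i\times U_i)$ is a coentourage. For $S\subseteq X$ the coarse star is $\mathrm{cst}(S,\mathcal U)=\bigcup\{U_i: S \text{ is close to } U_i\}$. Let $\mathbb Z_+$ be the non-negative integers with the standard metric. The set $\mathcal E(X)$ consists of endpoints: equivalence classes $[\phi]$ of coarse maps $\phi:\mathbb Z_+\to X$, where $\phi$ and $\psi$ are equivalent if $\phi(\mathbb Z_+)$ and $\psi(\mathbb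 Z_+)$ have finite Hausdorff distance. For a coarse cover $\mathcal U$ and endpoints $p=[\phi]$, $q=[\psi]$ write $q\in\mathcal U[p]$ if there is an entourage $E$ of $X$ with $\psi(\mathbb Z_+)\subseteq E[\mathrm{cst}(\phi(\mathbb Z_+),\mathcal U)]$ and $\phi(\mathbb Z_+)\subseteq E[\mathrm{cst}(\psi(\mathbb Z_+),\mathcal U)]$. The uniformity on $\mathcal E(X)$ has as base the sets $D_{\mathcal U}=\{(p,q): q\in\mathcal U[p]\}$, with $\mathcal U$ ranging over all coarse covers of $X$. *)

theory Defs
  imports "HOL-Analysis.Analysis"
begin

section \<open>Coarse geometry of a metric space\<close>

context Metric_space
begin

definition entourage :: "('a \<times> 'a) set \<Rightarrow> bool" where
  "entourage E \<longleftrightarrow> E \<subseteq> M \<times> M \<and> bdd_above ((\<lambda>(x, y). d x y) ` E)"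

text \<open>Boundedness is the library's \<open>mbounded\<close>.\<close>

lemma mbounded_iff_entourage: "mbounded B \<longleftrightarrow> entourage (B \<times> B)"
  by (auto simp: mbounded_alt entourage_def bdd_above_def)

definition coentourage :: "('a \<times> 'a) set \<Rightarrow> bool" where
  "coentourage C \<longleftrightarrow> C \<subseteq> M \<times> M \<and>
     (\<forall>(x :: nat \<Rightarrow> 'a) y. (\<forall>i. (x i, y i) \<in> C) \<longrightarrow>
        (mbounded (range x) \<and> mbounded (range y)) \<or> \<not> bdd_above (range (\<lambda>i. d (x i) (y i))))"

definition thicken :: "('a \<times> 'a) set \<Rightarrow> 'a set \<Rightarrow> 'a set" where
  "thicken E A = {x \<in> M. \<exists>a\<in>A. (x, a) \<in> E}"

definition close :: "'a set \<Rightarrow> 'a set \<Rightarrow> bool" where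
  "close A B \<longleftrightarrow> A \<subseteq> M \<and> B \<subseteq> M \<and> \<not> coentourage (A \<times> B)"

definition coarse_map :: "'b set \<Rightarrow> ('b \<Rightarrow> 'b \<Rightarrow> real) \<Rightarrow> ('a \<Rightarrow> 'b) \<Rightarrow> bool" where
  "coarse_map N e f \<longleftrightarrow> f \<in> M \<rightarrow> N \<and>
     (\<forall>E. entourage E \<longrightarrow> Metric_space.entourage N e (map_prod f f ` E)) \<and>
     (\<forall>B. Metric_space.mbounded N e B \<longrightarrow> mbounded (f -` B \<inter> M))"

text \<open>Repetitions in a finite family of subsets are irrelevant below, so a family is
  represented by the set of its members.\<close>

definition coarse_cover :: "'a set set \<Rightarrow> bool" where
  "coarse_cover \<U> \<longleftrightarrow> finite \<U> \<and> (\<forall>U\<in>\<U>. U \<subseteq> M) \<and> coentourage (M \<times> M - (\<Union>U\<in>\<U>. U \<times> U))"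

definition coarse_star :: "'a set \<Rightarrow> 'a set set \<Rightarrow> 'a set" where
  "coarse_star S \<U> = \<Union>{U \<in> \<U>. close S U}"

definition finite_hausdorff_dist :: "'a set \<Rightarrow> 'a set \<Rightarrow> bool" where
  "finite_hausdorff_dist A B \<longleftrightarrow>
     (\<exists>R. (\<forall>a\<in>A. \<exists>b\<in>B. d a b \<le> R) \<and> (\<forall>b\<in>B. \<exists>a\<in>A. d a b \<le> R))"


section \<open>The space of ends\<close>

definition coarse_rays :: "(nat \<Rightarrow> 'a) set" where
  "coarse_rays = {\<phi>. Metric_space.coarse_map UNIV (\<lambda>m n. \<bar>real m - real n\<bar>) M d \<phi>}"

definition end_rel :: "((nat \<Rightarrow> 'a) \<times> (nat \<Rightarrow> 'a)) set" where
  "end_rel = {(\<phi>, \<psi>). \<phi> \<in> coarse_rays \<and> \<psi> \<in> coarse_rays \<and>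
                finite_hausdorff_dist (range \<phi>) (range \<psi>)}"

definition endpoints :: "(nat \<Rightarrow> 'a) set set" where
  "endpoints = coarse_rays // end_rel"

text \<open>The condition on \<open>\<phi>\<close> and \<open>\<psi>\<close> below is invariant under finite Hausdorff distance, so
  quantifying existentially over representatives is harmless.\<close>

definition end_nbhd :: "'a set set \<Rightarrow> (nat \<Rightarrow> 'a) set \<Rightarrow> (nat \<Rightarrow> 'a) set set" where
  "end_nbhd \<U> p = {q \<in> endpoints. \<exists>\<phi>\<in>p. \<exists>\<psi>\<in>q. \<exists>E. entourage E \<and>
     range \<psi> \<subseteq> thicken E (coarse_star (range \<phi>) \<U>) \<and>
     range \<phi> \<subseteq> thicken E (coarse_star (range \<psi>) \<U>)}"

definition end_basic :: "'a set set \<Rightarrow> ((nat \<Rightarrow> 'a) set \<times> (nat \<Rightarrow> 'a) set) set" where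
  "end_basic \<U> = {(p, q). p \<in> endpoints \<and> q \<in> end_nbhd \<U> p}"

definition ends_uniformity :: "((nat \<Rightarrow> 'a) set \<times> (nat \<Rightarrow> 'a) set) set set" where
  "ends_uniformity =
     {D. D \<subseteq> endpoints \<times> endpoints \<and> (\<exists>\<U>. coarse_cover \<U> \<and> end_basic \<U> \<subseteq> D)}"

lemma metric_space_nat: "Metric_space UNIV (\<lambda>m n. \<bar>real m - real n\<bar>)"
  by unfold_locales auto

lemma equiv_end_rel: "equiv coarse_rays end_rel"
proof (rule equivI)
  have sub: "range \<phi> \<subseteq> M" if "\<phi> \<in> coarse_rays" for \<phi>
    using that
    by (auto simp: coarse_rays_def Metric_space.coarse_map_def[OF metric_space_nat])
  show "end_rel \<subseteq> coarse_rays \<times> coarse_rays"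
    by (auto simp: end_rel_def)
  show "refl_on coarse_rays end_rel"
  proof (rule refl_onI)
    fix \<phi> assume r: "\<phi> \<in> coarse_rays"
    have "d x x \<le> 0" if "x \<in> range \<phi>" for x
      using sub[OF r] that by (metis mdist_zero order_refl subsetD)
    then show "(\<phi>, \<phi>) \<in> end_rel"
      unfolding end_rel_def finite_hausdorff_dist_def using r by blast
  qed
  show "sym end_rel"
    unfolding end_rel_def finite_hausdorff_dist_def
    by (intro symI) (simp, metis commute)
  have step: "\<exists>c\<in>C. d a c \<le> R + R'"
    if h: "A \<subseteq> M" "B \<subseteq> M" "C \<subseteq> M" "\<forall>a\<in>A. \<exists>b\<in>B. d a b \<le> R" "\<forall>b\<in>B. \<exists>c\<in>C. d b c \<le> R'" "a \<in> A"
    for A B C R R' a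
  proof -
    obtain b where b: "b \<in> B" "d a b \<le> R" using h(4,6) by blast
    obtain c where c: "c \<in> C" "d b c \<le> R'" using h(5) b by blast
    have "d a c \<le> d a b + d b c" using h b c by (intro triangle) auto
    then show ?thesis using b c by force
  qed
  show "trans end_rel"
  proof (rule transI)
    fix \<phi> \<psi> \<theta> assume "(\<phi>, \<psi>) \<in> end_rel" "(\<psi>, \<theta>) \<in> end_rel"
    then obtain R R' where r: "\<phi> \<in> coarse_rays" "\<psi> \<in> coarse_rays" "\<theta> \<in> coarse_rays"
      and R: "\<forall>a\<in>range \<phi>. \<exists>b\<in>range \<psi>. d a b \<le> R" "\<forall>b\<in>range \<psi>. \<exists>a\<in>range \<phi>. d a b \<le> R"
      and R': "\<forall>a\<in>range \<psi>. \<exists>b\<in>range \<theta>. d a b \<le> R'" "\<forall>b\<in>range \<theta>. \<exists>a\<in>range \<psi>. d a b \<le> R'"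
      unfolding end_rel_def finite_hausdorff_dist_def by blast
    have 1: "\<forall>b\<in>range \<psi>. \<exists>a\<in>range \<phi>. d b a \<le> R" and 2: "\<forall>b\<in>range \<theta>. \<exists>a\<in>range \<psi>. d b a \<le> R'"
      using R(2) R'(2) by (metis commute)+
    have "\<forall>a\<in>range \<phi>. \<exists>c\<in>range \<theta>. d a c \<le> R + R'"
      using step[OF sub[OF r(1)] sub[OF r(2)] sub[OF r(3)] R(1) R'(1)] by blast
    moreover have "\<forall>c\<in>range \<theta>. \<exists>a\<in>range \<phi>. d a c \<le> R + R'"
      using step[OF sub[OF r(3)] sub[OF r(2)] sub[OF r(1)] 2 1]
      by (metis add.commute commute)
    ultimately show "(\<phi>, \<theta>) \<in> end_rel"
      using r by (auto simp: end_rel_def finite_hausdorff_dist_def)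
  qed
qed

end


section \<open>Uniform spaces on a carrier set\<close>

text \<open>The class \<open>uniform_space\<close> puts a uniformity on a whole (nonempty) type.  The space of
  ends depends on the metric space and may be empty, so uniformities on a set are given here by
  their sets of entourages.\<close>

definition uniform_space_on :: "'a set \<Rightarrow> ('a \<times> 'a) set set \<Rightarrow> bool" where
  "uniform_space_on S \<D> \<longleftrightarrow>
     \<D> \<noteq> {} \<and>
     (\<forall>D\<in>\<D>. Id_on S \<subseteq> D \<and> D \<subseteq> S \<times> S) \<and>
     (\<forall>D\<in>\<D>. \<forall>D'. D \<subseteq> D' \<and> D' \<subseteq> S \<times> S \<longrightarrow> D' \<in> \<D>) \<and>
     (\<forall>D\<in>\<D>. \<forall>D'\<in>\<D>. D \<inter> D' \<in> \<D>) \<and>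
     (\<forall>D\<in>\<D>. D\<inverse> \<in> \<D>) \<and>
     (\<forall>D\<in>\<D>. \<exists>D'\<in>\<D>. D' O D' \<subseteq> D)"

definition totally_bounded_on :: "'a set \<Rightarrow> ('a \<times> 'a) set set \<Rightarrow> bool" where
  "totally_bounded_on S \<D> \<longleftrightarrow>
     (\<forall>D\<in>\<D>. \<exists>F. finite F \<and> F \<subseteq> S \<and> (\<forall>s\<in>S. \<exists>x\<in>F. (x, s) \<in> D))"

definition separating_on :: "'a set \<Rightarrow> ('a \<times> 'a) set set \<Rightarrow> bool" where
  "separating_on S \<D> \<longleftrightarrow> \<Inter>\<D> = Id_on S"

end

theory Submission
  imports Defs
begin

text \<open>
  The argument reduces everything to the relation of being close, written here in terms of
  bounded sets: \<open>A\<close> and \<open>B\<close> are close iff for some \<open>R\<close> the points of \<open>A\<close> at distance at most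
  \<open>R\<close> from \<open>B\<close> form an unbounded set (lemma \<open>close_iff\<close>).  Closeness is symmetric, monotone,
  distributes over finite unions and does not see bounded displacements, and it is normal:
  if \<open>A\<close> and \<open>B\<close> are not close, the set \<open>C\<close> of points that are at least as near to some point
  of \<open>A\<close> as to all of \<open>B\<close> satisfies: \<open>A\<close> is not close to \<open>M - C\<close> and \<open>C\<close> is not close to \<open>B\<close>.
  A coarse ray enters the argument through its range, an unbounded set.

  Morally, a subset of \<open>M\<close> leaves a closed trace on the Higson corona, closeness means that
  traces meet, and the uniformity on ends is the Hausdorff uniformity on traces of rays.
  Compactness of the corona is replaced by finiteness of coarse covers.

  \<^item> Reflexivity: a ray lies, up to a bounded part, in its own star, since the parts of the ray
    in the members of the cover that are not close to it are bounded.
  \<^item> Total boundedness: the star of a ray depends only on the subset of the finite cover of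
    members close to the ray, so there are finitely many stars, and rays with the same star are
    related by reflexivity.
  \<^item> Composition: given a coarse cover, consider the finite partition of \<open>M\<close> into its atoms
    (points lying in the same members).  Two close atoms lie in a common member.  By normality
    the partition has a finite refinement in which a chain of four successively close parts
    starts and ends in close atoms.  The unions of two close parts of the refinement form a
    coarse cover whose relation, composed with itself, is contained in that of the given cover.
  \<^item> Separation: if the ray \<open>\<phi>\<close> is not within bounded distance of the ray \<open>\<psi>\<close>, then \<open>\<phi>\<close>
    contains an unbounded set \<open>A\<close> not close to \<open>\<psi>\<close>.  Normality gives \<open>C\<^sub>1\<close> and \<open>C\<^sub>2\<close> between
    \<open>A\<close> and the complement of \<open>\<psi>\<close>: each set of this chain is not close to the complement of
    the next one.  In the cover by \<open>M - C\<^sub>1\<close> and \<open>C\<^sub>2\<close> the star of \<open>\<psi>\<close> lies in \<open>M - C\<^sub>1\<close>,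
    which is not close to \<open>A\<close>.
\<close>

context Metric_space
begin

section \<open>Closeness in terms of bounded sets\<close>

lemma mbounded_neighbourhood:
  assumes "mbounded B" and "S \<subseteq> M" and "\<And>x. x \<in> S \<Longrightarrow> \<exists>b\<in>B. d x b \<le> R"
  shows "mbounded S"
proof (cases "S = {}")
  case False
  then have "B \<noteq> {}" using assms(3) by blast
  then obtain c r where c: "c \<in> M" "B \<subseteq> mcball c r"
    using assms(1) unfolding mbounded by (metis in_mcball subsetI)
  have "x \<in> mcball c (r + R)" if x: "x \<in> S" for x
  proof -
    obtain b where b: "b \<in> B" "d x b \<le> R" using assms(3)[OF x] by blast
    then have "b \<in> M" "d c b \<le> r" "x \<in> M" using c(2) x assms(2) by auto
    moreover have "d c x \<le> d c b + d b x" using calculation c by (intro triangle)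
    ultimately show ?thesis using b c commute[of b x] by auto
  qed
  then show ?thesis unfolding mbounded_def by blast
qed simp

text \<open>One projection suffices: a point at distance at most \<open>R\<close> from a bounded set is in a
  bounded set.\<close>

lemma coentourage_iff:
  "coentourage C \<longleftrightarrow> C \<subseteq> M \<times> M \<and> (\<forall>R. mbounded {x. \<exists>y. (x, y) \<in> C \<and> d x y \<le> R})"
proof (intro iffI conjI allI)
  assume C: "coentourage C"
  then show sub: "C \<subseteq> M \<times> M" by (simp add: coentourage_def)
  fix R
  let ?S = "{x. \<exists>y. (x, y) \<in> C \<and> d x y \<le> R}"
  show "mbounded ?S"
  proof (rule ccontr)
    assume unb: "\<not> mbounded ?S"
    then have "?S \<noteq> {}" using mbounded_empty by metis
    then obtain c where c: "c \<in> M" using sub by blast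
    have "\<exists>z. z \<in> C \<and> d (fst z) (snd z) \<le> R \<and> d c (fst z) > real n" for n
    proof (rule ccontr)
      assume "\<not> ?thesis"
      then have "?S \<subseteq> mcball c (real n)" using sub c by force
      then show False using unb unfolding mbounded_def by blast
    qed
    then obtain z where z: "\<And>n. z n \<in> C" "\<And>n. d (fst (z n)) (snd (z n)) \<le> R"
      "\<And>n. d c (fst (z n)) > real n" by metis
    have "bdd_above (range (\<lambda>i. d (fst (z i)) (snd (z i))))" using z(2) by (auto simp: bdd_above_def)
    moreover have "\<forall>i. (fst (z i), snd (z i)) \<in> C" using z(1) by simp
    ultimately have "mbounded (range (\<lambda>i. fst (z i)))"
      using C[unfolded coentourage_def, THEN conjunct2, rule_format, of "\<lambda>i. fst (z i)" "\<lambda>i. snd (z i)"]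
      by simp
    then have "mbounded (insert c (range (\<lambda>i. fst (z i))))" using c mbounded_insert by blast
    then obtain b where "\<And>i. d c (fst (z i)) \<le> b" unfolding mbounded_alt by blast
    moreover obtain n where "real n > b" using reals_Archimedean2 by blast
    ultimately show False using z(3)[of n] by (meson not_le order_less_trans)
  qed
next
  assume r: "C \<subseteq> M \<times> M \<and> (\<forall>R. mbounded {x. \<exists>y. (x, y) \<in> C \<and> d x y \<le> R})"
  show "coentourage C" unfolding coentourage_def
  proof (intro conjI allI impI disjCI)
    show "C \<subseteq> M \<times> M" using r by blast
    fix x y :: "nat \<Rightarrow> 'a"
    assume xy: "\<forall>i. (x i, y i) \<in> C" and "\<not> \<not> bdd_above (range (\<lambda>i. d (x i) (y i)))"
    then obtain R where R: "\<And>i. d (x i) (y i) \<le> R" by (auto simp: bdd_above_def)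
    let ?S = "{x. \<exists>y. (x, y) \<in> C \<and> d x y \<le> R}"
    have b: "mbounded ?S" using r by blast
    have s: "range x \<subseteq> ?S" using xy R by blast
    then show "mbounded (range x)" using b mbounded_subset by blast
    show "mbounded (range y)"
    proof (rule mbounded_neighbourhood[OF b])
      show "range y \<subseteq> M" using xy r by auto
      fix v assume "v \<in> range y"
      then obtain i where "v = y i" by blast
      then have "x i \<in> ?S" "d v (x i) \<le> R" using s R[of i] commute[of v "x i"] by auto
      then show "\<exists>b\<in>?S. d v b \<le> R" by (rule bexI[rotated])
    qed
  qed
qed

lemma close_iff:
  assumes "A \<subseteq> M" "B \<subseteq> M"
  shows "close A B \<longleftrightarrow> (\<exists>R. \<not> mbounded {a\<in>A. \<exists>b\<in>B. d a b \<le> R})"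
proof -
  have "{x. \<exists>y. (x, y) \<in> A \<times> B \<and> d x y \<le> R} = {a\<in>A. \<exists>b\<in>B. d a b \<le> R}" for R by auto
  moreover have "A \<times> B \<subseteq> M \<times> M" using assms by blast
  ultimately show ?thesis using assms by (simp add: close_def coentourage_iff)
qed

lemma close_subsetD: "close A B \<Longrightarrow> A \<subseteq> M \<and> B \<subseteq> M"
  by (simp add: close_def)

lemma closeE:
  assumes "close A B"
  obtains R where "\<not> mbounded {a\<in>A. \<exists>b\<in>B. d a b \<le> R}"
  using assms close_iff[of A B] close_subsetD[of A B] by metis

lemma not_close_mbounded:
  "\<not> close A B \<Longrightarrow> A \<subseteq> M \<Longrightarrow> B \<subseteq> M \<Longrightarrow> mbounded {a\<in>A. \<exists>b\<in>B. d a b \<le> R}"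
  by (simp add: close_iff)

lemma not_closeI:
  "A \<subseteq> M \<Longrightarrow> B \<subseteq> M \<Longrightarrow> (\<And>R. mbounded {a\<in>A. \<exists>b\<in>B. d a b \<le> R}) \<Longrightarrow> \<not> close A B"
  by (simp add: close_iff)

lemma close_sym:
  assumes "close A B"
  shows "close B A"
proof (rule ccontr)
  assume n: "\<not> close B A"
  have AB: "A \<subseteq> M" "B \<subseteq> M" using assms by (auto dest: close_subsetD)
  obtain R where R: "\<not> mbounded {a\<in>A. \<exists>b\<in>B. d a b \<le> R}" using closeE[OF assms] .
  have "mbounded {b\<in>B. \<exists>a\<in>A. d b a \<le> R}" by (rule not_close_mbounded[OF n AB(2,1)])
  then have "mbounded {a\<in>A. \<exists>b\<in>B. d a b \<le> R}"
  proof (rule mbounded_neighbourhood)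
    show "{a\<in>A. \<exists>b\<in>B. d a b \<le> R} \<subseteq> M" using AB by blast
    show "\<exists>b\<in>{b\<in>B. \<exists>a\<in>A. d b a \<le> R}. d x b \<le> R" if "x \<in> {a\<in>A. \<exists>b\<in>B. d a b \<le> R}" for x
      using that by (auto simp: commute[of x])
  qed
  then show False using R by blast
qed

lemma coentourage_subset: "coentourage C \<Longrightarrow> C' \<subseteq> C \<Longrightarrow> coentourage C'"
  unfolding coentourage_def by (meson subsetD subset_trans)

lemma coentourage_Un:
  assumes "coentourage C" "coentourage C'"
  shows "coentourage (C \<union> C')"
proof -
  have "{x. \<exists>y. (x, y) \<in> C \<union> C' \<and> d x y \<le> R} =
      {x. \<exists>y. (x, y) \<in> C \<and> d x y \<le> R} \<union> {x. \<exists>y. (x, y) \<in> C' \<and> d x y \<le> R}" for R by blast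
  then show ?thesis using assms unfolding coentourage_iff by (simp only: mbounded_Un) simp
qed

lemma coentourage_Union:
  assumes "finite \<C>" and "\<And>C. C \<in> \<C> \<Longrightarrow> coentourage C"
  shows "coentourage (\<Union>\<C>)"
  using assms
proof (induction \<C>)
  case empty
  show ?case by (simp add: coentourage_def)
next
  case (insert C \<C>)
  then show ?case by (simp add: coentourage_Un)
qed

lemma close_mono:
  assumes "close A B" "A \<subseteq> A'" "A' \<subseteq> M" "B \<subseteq> B'" "B' \<subseteq> M"
  shows "close A' B'"
  using assms coentourage_subset[of "A' \<times> B'" "A \<times> B"] by (auto simp: close_def)

lemma close_UnionD:
  assumes "close A (\<Union>\<B>)" "finite \<B>"
  shows "\<exists>B\<in>\<B>. close A B"
proof (rule ccontr)
  assume "\<not> ?thesis"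
  then have "coentourage (A \<times> B)" if "B \<in> \<B>" for B using that assms by (auto simp: close_def)
  then have "coentourage (\<Union>((\<lambda>B. A \<times> B) ` \<B>))" using assms(2) by (intro coentourage_Union) auto
  moreover have "\<Union>((\<lambda>B. A \<times> B) ` \<B>) = A \<times> \<Union>\<B>" by blast
  ultimately show False using assms(1) by (simp add: close_def)
qed

lemma close_Un_iff:
  assumes "B \<subseteq> M" "C \<subseteq> M"
  shows "close A (B \<union> C) \<longleftrightarrow> close A B \<or> close A C"
proof
  assume "close A (B \<union> C)"
  then show "close A B \<or> close A C" using close_UnionD[of A "{B, C}"] by simp
next
  have "close A (B \<union> C)" if "close A V" "V \<subseteq> B \<union> C" for V
    using close_mono[OF that(1) subset_refl _ that(2)] close_subsetD[OF that(1)] assms by simp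
  then show "close A B \<or> close A C \<Longrightarrow> close A (B \<union> C)" by blast
qed

lemma close_self_iff:
  assumes A: "A \<subseteq> M"
  shows "close A A \<longleftrightarrow> \<not> mbounded A"
proof -
  have "d a a \<le> 0" if "a \<in> A" for a using A that by (simp add: subset_iff)
  then have eq: "{a\<in>A. \<exists>b\<in>A. d a b \<le> 0} = A" by blast
  show ?thesis
  proof
    assume "close A A"
    then obtain R where "\<not> mbounded {a\<in>A. \<exists>b\<in>A. d a b \<le> R}" by (rule closeE)
    moreover have "{a\<in>A. \<exists>b\<in>A. d a b \<le> R} \<subseteq> A" by blast
    ultimately show "\<not> mbounded A" by (blast intro: mbounded_subset)
  next
    assume "\<not> mbounded A"
    then show "close A A" using not_close_mbounded[OF _ A A, of 0] eq by auto
  qed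
qed

lemma close_imp_self:
  assumes "close A B"
  shows "close A A"
proof -
  have AB: "A \<subseteq> M" "B \<subseteq> M" using assms by (auto dest: close_subsetD)
  obtain R where R: "\<not> mbounded {a\<in>A. \<exists>b\<in>B. d a b \<le> R}" using closeE[OF assms] .
  moreover have "{a\<in>A. \<exists>b\<in>B. d a b \<le> R} \<subseteq> A" by blast
  ultimately have "\<not> mbounded A" using mbounded_subset by blast
  then show ?thesis using AB close_self_iff by blast
qed

text \<open>Normality: the set \<open>C\<close> consists of the points that are at least as near to some point of
  \<open>A\<close> as to every point of \<open>B\<close>.  A point of \<open>C\<close> near \<open>B\<close>, or a point outside \<open>C\<close> near \<open>A\<close>, is
  near both sets, and the points of \<open>A\<close> near \<open>B\<close> are bounded.\<close>

lemma not_close_interpolate: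
  assumes AB: "A \<subseteq> M" "B \<subseteq> M" and far: "\<not> close A B"
  obtains C where "C \<subseteq> M" "\<not> close A (M - C)" "\<not> close C B"
proof -
  define C where "C = {x\<in>M. \<exists>a\<in>A. \<forall>b\<in>B. d x a \<le> d x b}"
  have CM: "C \<subseteq> M" "M - C \<subseteq> M" by (auto simp: C_def)
  have bdd: "mbounded {a\<in>A. \<exists>b\<in>B. d a b \<le> R}" for R by (rule not_close_mbounded[OF far AB])
  have CB: "mbounded {x\<in>C. \<exists>b\<in>B. d x b \<le> R}" for R
  proof (rule mbounded_neighbourhood[OF bdd[of "R + R"]])
    show "{x\<in>C. \<exists>b\<in>B. d x b \<le> R} \<subseteq> M" using CM by blast
    fix x assume "x \<in> {x\<in>C. \<exists>b\<in>B. d x b \<le> R}"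
    then obtain a b where ab: "x \<in> M" "a \<in> A" "b \<in> B" "d x b \<le> R" "d x a \<le> R"
      unfolding C_def by force
    have "d a b \<le> d a x + d x b" using ab AB by (intro triangle) auto
    then show "\<exists>a\<in>{a\<in>A. \<exists>b\<in>B. d a b \<le> R + R}. d x a \<le> R" using ab commute[of a x] by force
  qed
  have AC: "mbounded {a\<in>A. \<exists>y\<in>M - C. d a y \<le> R}" for R
  proof (rule mbounded_subset[OF bdd[of "R + R"]], safe)
    fix a y assume a: "a \<in> A" and y: "y \<in> M" "y \<notin> C" "d a y \<le> R"
    then obtain b where b: "b \<in> B" "d y b < d y a" unfolding C_def by force
    have "d a b \<le> d a y + d y b" using a y b AB by (intro triangle) auto
    then show "\<exists>b\<in>B. d a b \<le> R + R" using b y commute[of a y] by force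
  qed
  show ?thesis using that[OF CM(1) not_closeI[OF AB(1) CM(2) AC] not_closeI[OF CM(1) AB(2) CB]] .
qed

section \<open>Bounded displacement\<close>

definition coarsely_in :: "'a set \<Rightarrow> 'a set \<Rightarrow> bool" where
  "coarsely_in S T \<longleftrightarrow> (\<exists>R. \<forall>x\<in>S. \<exists>y\<in>T. d x y \<le> R)"

lemma coarsely_in_trans:
  assumes "coarsely_in S T" "coarsely_in T U" "S \<subseteq> M" "T \<subseteq> M" "U \<subseteq> M"
  shows "coarsely_in S U"
proof -
  obtain R R' where R: "\<forall>x\<in>S. \<exists>y\<in>T. d x y \<le> R" "\<forall>y\<in>T. \<exists>z\<in>U. d y z \<le> R'"
    using assms(1,2) unfolding coarsely_in_def by blast
  have "\<exists>z\<in>U. d x z \<le> R + R'" if x: "x \<in> S" for x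
  proof -
    obtain y z where yz: "y \<in> T" "d x y \<le> R" "z \<in> U" "d y z \<le> R'" using R x by blast
    have "d x z \<le> d x y + d y z" using assms(3-) x yz by (intro triangle) auto
    then show ?thesis using yz by force
  qed
  then show ?thesis unfolding coarsely_in_def by blast
qed

lemma coarsely_in_mono: "coarsely_in S T \<Longrightarrow> S' \<subseteq> S \<Longrightarrow> T \<subseteq> T' \<Longrightarrow> coarsely_in S' T'"
  unfolding coarsely_in_def by (meson subsetD)

lemma finite_hausdorff_dist_iff:
  "finite_hausdorff_dist S T \<longleftrightarrow> coarsely_in S T \<and> coarsely_in T S"
proof
  assume "finite_hausdorff_dist S T"
  then show "coarsely_in S T \<and> coarsely_in T S"
    unfolding finite_hausdorff_dist_def coarsely_in_def by (metis commute)
next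
  assume "coarsely_in S T \<and> coarsely_in T S"
  then obtain R R' where R: "\<forall>x\<in>S. \<exists>y\<in>T. d x y \<le> R" "\<forall>x\<in>T. \<exists>y\<in>S. d x y \<le> R'"
    unfolding coarsely_in_def by blast
  then have "\<forall>x\<in>S. \<exists>y\<in>T. d x y \<le> max R R'" "\<forall>x\<in>T. \<exists>y\<in>S. d y x \<le> max R R'"
    by (metis max.coboundedI1, metis max.coboundedI2 commute)
  then show "finite_hausdorff_dist S T" unfolding finite_hausdorff_dist_def by blast
qed

text \<open>A single entourage can serve for two inclusions, because entourages of the form
  \<open>d x y \<le> R\<close> are cofinal.\<close>

lemma ex_entourage_thicken_iff:
  assumes M: "S \<subseteq> M" "T \<subseteq> M" "S' \<subseteq> M" "T' \<subseteq> M"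
  shows "(\<exists>E. entourage E \<and> S \<subseteq> thicken E T \<and> S' \<subseteq> thicken E T') \<longleftrightarrow>
    coarsely_in S T \<and> coarsely_in S' T'"
proof
  assume "\<exists>E. entourage E \<and> S \<subseteq> thicken E T \<and> S' \<subseteq> thicken E T'"
  then obtain E where E: "entourage E" "S \<subseteq> thicken E T" "S' \<subseteq> thicken E T'" by blast
  then obtain R where "\<forall>(x, y)\<in>E. d x y \<le> R" unfolding entourage_def bdd_above_def by blast
  then have "\<forall>x\<in>S. \<exists>y\<in>T. d x y \<le> R" "\<forall>x\<in>S'. \<exists>y\<in>T'. d x y \<le> R"
    using E unfolding thicken_def by blast+
  then show "coarsely_in S T \<and> coarsely_in S' T'" unfolding coarsely_in_def by blast
next
  assume "coarsely_in S T \<and> coarsely_in S' T'"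
  then obtain R R' where R: "\<forall>x\<in>S. \<exists>y\<in>T. d x y \<le> R" "\<forall>x\<in>S'. \<exists>y\<in>T'. d x y \<le> R'"
    unfolding coarsely_in_def by blast
  let ?E = "{(x, y). x \<in> M \<and> y \<in> M \<and> d x y \<le> max R R'}"
  have "entourage ?E" unfolding entourage_def bdd_above_def by auto
  moreover have "S \<subseteq> thicken ?E T" "S' \<subseteq> thicken ?E T'"
    using R M unfolding thicken_def by (auto simp: le_max_iff_disj subset_iff)
  ultimately show "\<exists>E. entourage E \<and> S \<subseteq> thicken E T \<and> S' \<subseteq> thicken E T'" by blast
qed

text \<open>A displacement by at most \<open>R\<close> replaces the bound \<open>R'\<close> in closeness by \<open>R + R'\<close>.  This makes
  the star of a ray depend only on its class, and it passes closeness from a ray on to a star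
  that contains the ray up to bounded distance.\<close>

lemma close_coarsely_in:
  assumes cl: "close S A" and co: "coarsely_in S T" and T: "T \<subseteq> M"
  shows "close T A"
proof (rule ccontr)
  assume n: "\<not> close T A"
  have SA: "S \<subseteq> M" "A \<subseteq> M" using cl by (auto dest: close_subsetD)
  obtain R where R: "\<forall>x\<in>S. \<exists>y\<in>T. d x y \<le> R" using co unfolding coarsely_in_def by blast
  obtain R' where R': "\<not> mbounded {x\<in>S. \<exists>a\<in>A. d x a \<le> R'}" using closeE[OF cl] .
  have "mbounded {y\<in>T. \<exists>a\<in>A. d y a \<le> R + R'}" by (rule not_close_mbounded[OF n T SA(2)])
  then have "mbounded {x\<in>S. \<exists>a\<in>A. d x a \<le> R'}"
  proof (rule mbounded_neighbourhood)
    show "{x\<in>S. \<exists>a\<in>A. d x a \<le> R'} \<subseteq> M" using SA by blast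
    fix x assume "x \<in> {x\<in>S. \<exists>a\<in>A. d x a \<le> R'}"
    then obtain a y where a: "x \<in> S" "a \<in> A" "d x a \<le> R'" "y \<in> T" "d x y \<le> R" using R by blast
    have "d y a \<le> d y x + d x a" using a SA T by (intro triangle) auto
    then show "\<exists>y\<in>{y\<in>T. \<exists>a\<in>A. d y a \<le> R + R'}. d x y \<le> R" using a commute[of x y] by force
  qed
  then show False using R' by blast
qed

section \<open>Stars and the induced relation on subsets\<close>

text \<open>The relation defining the uniformity, on subsets instead of classes of rays.\<close>

definition star_near :: "'a set set \<Rightarrow> 'a set \<Rightarrow> 'a set \<Rightarrow> bool" where
  "star_near \<U> S T \<longleftrightarrow>
     coarsely_in S (coarse_star T \<U>) \<and> coarsely_in T (coarse_star S \<U>)"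

lemma coarse_coverD:
  assumes "coarse_cover \<U>"
  shows "finite \<U>" "\<And>U. U \<in> \<U> \<Longrightarrow> U \<subseteq> M"
  using assms by (auto simp: coarse_cover_def)

lemma coarse_star_subset: "coarse_star S \<U> \<subseteq> M"
  by (auto simp: coarse_star_def dest: close_subsetD)

lemma coarse_star_coarsely_in:
  "coarsely_in S T \<Longrightarrow> T \<subseteq> M \<Longrightarrow> coarse_star S \<U> \<subseteq> coarse_star T \<U>"
  unfolding coarse_star_def using close_coarsely_in by blast

lemma star_near_finite_hausdorff_dist:
  assumes "star_near \<U> S T" "finite_hausdorff_dist S S'" "finite_hausdorff_dist T T'"
    and M: "S \<subseteq> M" "T \<subseteq> M" "S' \<subseteq> M" "T' \<subseteq> M"
  shows "star_near \<U> S' T'"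
proof -
  have "coarse_star S \<U> \<subseteq> coarse_star S' \<U>" "coarse_star T \<U> \<subseteq> coarse_star T' \<U>"
    using assms coarse_star_coarsely_in by (auto simp: finite_hausdorff_dist_iff)
  then show ?thesis
    using assms coarsely_in_trans[of S' S] coarsely_in_trans[of T' T] coarse_star_subset
      coarsely_in_mono[OF _ order_refl]
    unfolding star_near_def finite_hausdorff_dist_iff by meson
qed

text \<open>The part of \<open>S\<close> outside its star is bounded: apart from points in no member of the cover, it
  lies in the finitely many \<open>S \<inter> U\<close> with \<open>U\<close> not close to \<open>S\<close>.\<close>

lemma coarsely_in_own_star:
  assumes cov: "coarse_cover \<U>" and S: "S \<subseteq> M" "\<not> mbounded S"
  shows "coarsely_in S (coarse_star S \<U>)"
proof -
  let ?N = "{x. \<exists>y. (x, y) \<in> M \<times> M - (\<Union>U\<in>\<U>. U \<times> U) \<and> d x y \<le> 0}"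
  let ?\<F> = "(\<lambda>U. S \<inter> U) ` {U\<in>\<U>. \<not> close S U}"
  have N: "mbounded ?N"
    using cov[unfolded coarse_cover_def coentourage_iff] by (elim conjE) (erule spec)
  have F: "mbounded (S \<inter> U)" if "U \<in> \<U>" "\<not> close S U" for U
  proof -
    have UM: "U \<subseteq> M" using cov that coarse_coverD by blast
    have "mbounded {a\<in>S. \<exists>b\<in>U. d a b \<le> 0}" by (rule not_close_mbounded[OF that(2) S(1) UM])
    moreover have "S \<inter> U \<subseteq> {a\<in>S. \<exists>b\<in>U. d a b \<le> 0}"
      using S by auto (metis mdist_zero order_refl subsetD)
    ultimately show ?thesis using mbounded_subset by blast
  qed
  have "mbounded (\<Union>?\<F>)" using F coarse_coverD(1)[OF cov] by (intro mbounded_Union) auto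
  moreover have sub: "S - coarse_star S \<U> \<subseteq> ?N \<union> \<Union>?\<F>"
  proof
    fix x assume x: "x \<in> S - coarse_star S \<U>"
    show "x \<in> ?N \<union> \<Union>?\<F>"
    proof (cases "x \<in> \<Union>\<U>")
      case True
      then show ?thesis using x unfolding coarse_star_def by auto
    next
      case False
      then have "(x, x) \<in> M \<times> M - (\<Union>U\<in>\<U>. U \<times> U)" "d x x \<le> 0" using x S by auto
      then show ?thesis by blast
    qed
  qed
  ultimately have bdd: "mbounded (S - coarse_star S \<U>)"
    using N mbounded_Un mbounded_subset by blast
  have "S \<inter> coarse_star S \<U> \<noteq> {}"
  proof
    assume "S \<inter> coarse_star S \<U> = {}"
    then have "S - coarse_star S \<U> = S" by blast
    then show False using bdd S by simp
  qed
  then obtain s where s: "s \<in> S" "s \<in> coarse_star S \<U>" by blast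
  then have "mbounded (insert s (S - coarse_star S \<U>))" using bdd S mbounded_insert by blast
  then obtain r where r: "\<And>x. x \<in> S - coarse_star S \<U> \<Longrightarrow> d x s \<le> r"
    unfolding mbounded_alt by blast
  have "\<exists>y\<in>coarse_star S \<U>. d x y \<le> max r 0" if "x \<in> S" for x
  proof (cases "x \<in> coarse_star S \<U>")
    case True
    then show ?thesis using that S by (intro bexI[of _ x]) auto
  next
    case False
    then show ?thesis using that r[of x] s by (intro bexI[of _ s]) auto
  qed
  then show ?thesis unfolding coarsely_in_def by blast
qed

lemma star_near_if_same_members_close:
  assumes "coarse_cover \<U>" "S \<subseteq> M" "T \<subseteq> M" "\<not> mbounded S" "\<not> mbounded T"
    and "{U\<in>\<U>. close S U} = {U\<in>\<U>. close T U}"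
  shows "star_near \<U> S T"
  using assms coarsely_in_own_star[of \<U> S] coarsely_in_own_star[of \<U> T]
  unfolding star_near_def coarse_star_def by simp

lemma coarse_cover_Int:
  assumes "coarse_cover \<U>" "coarse_cover \<V>"
  shows "coarse_cover ((\<lambda>(U, V). U \<inter> V) ` (\<U> \<times> \<V>))" (is "coarse_cover ?\<W>")
proof -
  have "(\<Union>U\<in>\<U>. U \<times> U) \<inter> (\<Union>V\<in>\<V>. V \<times> V) \<subseteq> (\<Union>W\<in>?\<W>. W \<times> W)" by auto
  then have "M \<times> M - (\<Union>W\<in>?\<W>. W \<times> W) \<subseteq>
      (M \<times> M - (\<Union>U\<in>\<U>. U \<times> U)) \<union> (M \<times> M - (\<Union>V\<in>\<V>. V \<times> V))" by blast
  moreover have "coentourage ((M \<times> M - (\<Union>U\<in>\<U>. U \<times> U)) \<union> (M \<times> M - (\<Union>V\<in>\<V>. V \<times> V)))"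
    using assms by (intro coentourage_Un) (simp_all add: coarse_cover_def)
  ultimately have "coentourage (M \<times> M - (\<Union>W\<in>?\<W>. W \<times> W))"
    by (rule coentourage_subset[rotated])
  moreover have "finite ?\<W>" "\<forall>W\<in>?\<W>. W \<subseteq> M" using assms unfolding coarse_cover_def by auto
  ultimately show ?thesis unfolding coarse_cover_def by blast
qed

lemma star_near_refine:
  assumes "star_near \<V> S T" and "\<And>V. V \<in> \<V> \<Longrightarrow> \<exists>U\<in>\<U>. V \<subseteq> U" and "\<And>U. U \<in> \<U> \<Longrightarrow> U \<subseteq> M"
  shows "star_near \<U> S T"
proof -
  have "coarse_star A \<V> \<subseteq> coarse_star A \<U>" for A
  proof
    fix x assume "x \<in> coarse_star A \<V>"
    then obtain V where V: "V \<in> \<V>" "close A V" "x \<in> V" unfolding coarse_star_def by blast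
    then obtain U where U: "U \<in> \<U>" "V \<subseteq> U" using assms(2) by blast
    have "close A U"
      using close_mono[OF V(2) subset_refl _ U(2) assms(3)[OF U(1)]] close_subsetD[OF V(2)] by simp
    then show "x \<in> coarse_star A \<U>" using U V unfolding coarse_star_def by blast
  qed
  then show ?thesis
    using assms(1) coarsely_in_mono[OF _ subset_refl] unfolding star_near_def by metis
qed

section \<open>Composition\<close>

definition atom :: "'a set set \<Rightarrow> 'a \<Rightarrow> 'a set" where
  "atom \<S> x = {y\<in>M. \<forall>S\<in>\<S>. x \<in> S \<longleftrightarrow> y \<in> S}"

lemma atom_subset: "atom \<S> x \<subseteq> M"
  by (auto simp: atom_def)

lemma atom_self: "x \<in> M \<Longrightarrow> x \<in> atom \<S> x"
  by (auto simp: atom_def)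

lemma atom_antimono: "\<S> \<subseteq> \<T> \<Longrightarrow> atom \<T> x \<subseteq> atom \<S> x"
  by (auto simp: atom_def)

lemma finite_atoms:
  assumes "finite \<S>"
  shows "finite (range (atom \<S>))"
proof -
  have "range (atom \<S>) \<subseteq> (\<lambda>\<T>. {y\<in>M. \<forall>S\<in>\<S>. S \<in> \<T> \<longleftrightarrow> y \<in> S}) ` Pow \<S>"
  proof
    fix A assume "A \<in> range (atom \<S>)"
    then obtain x where "A = atom \<S> x" by blast
    then show "A \<in> (\<lambda>\<T>. {y\<in>M. \<forall>S\<in>\<S>. S \<in> \<T> \<longleftrightarrow> y \<in> S}) ` Pow \<S>"
      by (intro image_eqI[of _ _ "{S\<in>\<S>. x \<in> S}"]) (auto simp: atom_def)
  qed
  then show ?thesis by (rule finite_subset) (use assms in simp)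
qed

lemma atom_in_or_out: "S \<in> \<S> \<Longrightarrow> atom \<S> x \<subseteq> S \<or> atom \<S> x \<subseteq> M - S"
  by (auto simp: atom_def)

lemma close_atom_subset:
  assumes "close A (atom \<S> x)" "A \<subseteq> B" "B \<subseteq> M" "\<not> close B (M - C)" "C \<in> \<S>"
  shows "atom \<S> x \<subseteq> C"
proof (rule ccontr)
  assume "\<not> ?thesis"
  then have "atom \<S> x \<subseteq> M - C" using assms(5) atom_in_or_out by blast
  then have "close B (M - C)" using assms by (intro close_mono[OF assms(1)]) auto
  then show False using assms by blast
qed

text \<open>The discrete form of the existence of a uniformity inducing closeness.  For parts
  \<open>P\<close>, \<open>Q\<close> that are not close, two sets \<open>C\<^sub>1\<close> and \<open>C\<^sub>2\<close> with \<open>P\<close>, \<open>C\<^sub>1\<close>, \<open>C\<^sub>2\<close>, \<open>M - Q\<close> each not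
  close to the complement of the next are added to the family: a chain from \<open>P\<close> has its second
  part in \<open>C\<^sub>1\<close> and its third in \<open>C\<^sub>2\<close>, so its fourth is not in \<open>Q\<close>.\<close>

lemma ex_chain_refinement:
  assumes fin: "finite \<S>"
  obtains \<T> where "finite \<T>" "\<S> \<subseteq> \<T>"
    "\<And>x y z w. close (atom \<T> x) (atom \<T> y) \<Longrightarrow> close (atom \<T> y) (atom \<T> z) \<Longrightarrow>
      close (atom \<T> z) (atom \<T> w) \<Longrightarrow> close (atom \<S> x) (atom \<S> w)"
proof -
  have "\<exists>C1 C2. \<not> close P Q \<longrightarrow> C1 \<subseteq> M \<and> C2 \<subseteq> M \<and>
      \<not> close P (M - C1) \<and> \<not> close C1 (M - C2) \<and> \<not> close C2 Q"
    if PQ: "P \<subseteq> M" "Q \<subseteq> M" for P Q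
  proof (cases "close P Q")
    case False
    obtain C2 where C2: "C2 \<subseteq> M" "\<not> close P (M - C2)" "\<not> close C2 Q"
      using not_close_interpolate[OF PQ False] by blast
    obtain C1 where "C1 \<subseteq> M" "\<not> close P (M - C1)" "\<not> close C1 (M - C2)"
      using not_close_interpolate[OF PQ(1) _ C2(2)] by blast
    then show ?thesis using C2 by blast
  qed simp
  then obtain C1 C2 where C: "\<And>P Q. P \<subseteq> M \<Longrightarrow> Q \<subseteq> M \<Longrightarrow> \<not> close P Q \<Longrightarrow>
      C1 P Q \<subseteq> M \<and> C2 P Q \<subseteq> M \<and>
      \<not> close P (M - C1 P Q) \<and> \<not> close (C1 P Q) (M - C2 P Q) \<and> \<not> close (C2 P Q) Q"
    by metis
  let ?A = "range (atom \<S>)"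
  define \<T> where "\<T> = \<S> \<union> (\<lambda>(P, Q). C1 P Q) ` (?A \<times> ?A) \<union> (\<lambda>(P, Q). C2 P Q) ` (?A \<times> ?A)"
  have finT: "finite \<T>" using fin finite_atoms unfolding \<T>_def by simp
  have ST: "\<S> \<subseteq> \<T>" unfolding \<T>_def by blast
  have "close (atom \<S> x) (atom \<S> w)"
    if xy: "close (atom \<T> x) (atom \<T> y)" and yz: "close (atom \<T> y) (atom \<T> z)"
      and zw: "close (atom \<T> z) (atom \<T> w)" for x y z w
  proof (rule ccontr)
    let ?P = "atom \<S> x" and ?Q = "atom \<S> w"
    assume "\<not> close ?P ?Q"
    from C[OF atom_subset atom_subset this]
    have C': "C1 ?P ?Q \<subseteq> M" "C2 ?P ?Q \<subseteq> M" "\<not> close ?P (M - C1 ?P ?Q)"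
      "\<not> close (C1 ?P ?Q) (M - C2 ?P ?Q)" "\<not> close (C2 ?P ?Q) ?Q" by blast+
    have mem: "C1 ?P ?Q \<in> \<T>" "C2 ?P ?Q \<in> \<T>" unfolding \<T>_def by force+
    have "atom \<T> y \<subseteq> C1 ?P ?Q"
      using close_atom_subset[OF xy atom_antimono[OF ST] atom_subset C'(3) mem(1)] .
    then have "atom \<T> z \<subseteq> C2 ?P ?Q"
      using close_atom_subset[OF yz _ C'(1) C'(4) mem(2)] by blast
    then have "close (C2 ?P ?Q) ?Q"
      using close_mono[OF zw _ C'(2) atom_antimono[OF ST] atom_subset] by blast
    then show False using C' by blast
  qed
  then show ?thesis using that finT ST by blast
qed

lemma ex_member_of_close_atoms:
  assumes cov: "coarse_cover \<U>" and cl: "close (atom \<U> x) (atom \<U> y)"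
  obtains U where "U \<in> \<U>" "atom \<U> x \<subseteq> U" "atom \<U> y \<subseteq> U"
proof -
  have "\<not> coentourage (atom \<U> x \<times> atom \<U> y)" using cl by (simp add: close_def)
  moreover have "coentourage (M \<times> M - (\<Union>U\<in>\<U>. U \<times> U))" using cov by (simp add: coarse_cover_def)
  ultimately have "\<not> atom \<U> x \<times> atom \<U> y \<subseteq> M \<times> M - (\<Union>U\<in>\<U>. U \<times> U)"
    using coentourage_subset by metis
  moreover have "atom \<U> x \<times> atom \<U> y \<subseteq> M \<times> M" using atom_subset by blast
  ultimately obtain a b U where "a \<in> atom \<U> x" "b \<in> atom \<U> y" "U \<in> \<U>" "a \<in> U" "b \<in> U"
    by blast
  then show ?thesis using that[of U] atom_in_or_out[of U \<U>] by blast
qed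

text \<open>Points of two parts that are not close are a pair at bounded distance only in a bounded
  region, so the unions of two close parts capture all other pairs.\<close>

lemma coarse_cover_close_pairs:
  assumes fin: "finite \<W>" and sub: "\<And>W. W \<in> \<W> \<Longrightarrow> W \<subseteq> M" and M: "M \<subseteq> \<Union>\<W>"
  shows "coarse_cover {V \<union> W | V W. V \<in> \<W> \<and> W \<in> \<W> \<and> close V W}" (is "coarse_cover ?\<V>")
proof -
  have "?\<V> \<subseteq> (\<lambda>(V, W). V \<union> W) ` (\<W> \<times> \<W>)" by auto
  then have "finite ?\<V>" by (rule finite_subset) (use fin in simp)
  moreover have "\<forall>V\<in>?\<V>. V \<subseteq> M" using sub by blast
  moreover have "coentourage (M \<times> M - (\<Union>V\<in>?\<V>. V \<times> V))"
  proof -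
    let ?\<C> = "(\<lambda>(V, W). V \<times> W) ` {(V, W) \<in> \<W> \<times> \<W>. \<not> close V W}"
    have "coentourage (\<Union>?\<C>)"
    proof (rule coentourage_Union)
      have "{(V, W) \<in> \<W> \<times> \<W>. \<not> close V W} \<subseteq> \<W> \<times> \<W>" by blast
      then show "finite ?\<C>" by (intro finite_imageI) (rule finite_subset, use fin in auto)
      show "coentourage C" if "C \<in> ?\<C>" for C using that sub by (auto simp: close_def)
    qed
    moreover have "M \<times> M - (\<Union>V\<in>?\<V>. V \<times> V) \<subseteq> \<Union>?\<C>"
    proof
      fix p assume p: "p \<in> M \<times> M - (\<Union>V\<in>?\<V>. V \<times> V)"
      obtain x y where xy: "p = (x, y)" by fastforce
      have "x \<in> \<Union>\<W>" "y \<in> \<Union>\<W>" using p M by (auto simp: xy)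
      then obtain V W where VW: "V \<in> \<W>" "W \<in> \<W>" "x \<in> V" "y \<in> W" by blast
      have "\<not> close V W"
      proof
        assume "close V W"
        then have "V \<union> W \<in> ?\<V>" using VW by blast
        moreover have "(x, y) \<in> (V \<union> W) \<times> (V \<union> W)" using VW by simp
        ultimately have "p \<in> (\<Union>V\<in>?\<V>. V \<times> V)" unfolding xy by (rule UN_I)
        then show False using p by simp
      qed
      then show "p \<in> \<Union>?\<C>" using xy VW by auto
    qed
    ultimately show ?thesis by (rule coentourage_subset)
  qed
  ultimately show ?thesis unfolding coarse_cover_def by blast
qed

text \<open>Let \<open>\<V>\<close> consist of the unions of two close parts of the refinement.  A member of \<open>\<V>\<close> close
  to \<open>T\<close> is close to some member of \<open>\<V>\<close> that is close to \<open>S\<close>, since \<open>T\<close> stays within bounded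
  distance of the star of \<open>S\<close>.  This links any part of the first member to a part close to \<open>S\<close>
  by a chain of four close parts.\<close>

lemma ex_cover_star_near_trans:
  assumes cov: "coarse_cover \<U>"
  obtains \<V> where "coarse_cover \<V>"
    "\<And>S T Q. star_near \<V> S T \<Longrightarrow> star_near \<V> T Q \<Longrightarrow> star_near \<U> S Q"
proof -
  obtain \<T> where T: "finite \<T>" "\<U> \<subseteq> \<T>"
    and chain: "\<And>x y z w. close (atom \<T> x) (atom \<T> y) \<Longrightarrow> close (atom \<T> y) (atom \<T> z) \<Longrightarrow>
      close (atom \<T> z) (atom \<T> w) \<Longrightarrow> close (atom \<U> x) (atom \<U> w)"
    using ex_chain_refinement[OF coarse_coverD(1)[OF cov]] by blast
  let ?\<W> = "range (atom \<T>)"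
  define \<V> where "\<V> = {V \<union> W | V W. V \<in> ?\<W> \<and> W \<in> ?\<W> \<and> close V W}"
  have covV: "coarse_cover \<V>" unfolding \<V>_def
  proof (rule coarse_cover_close_pairs)
    show "finite ?\<W>" using T finite_atoms by blast
    show "W \<subseteq> M" if "W \<in> ?\<W>" for W using that atom_subset by blast
    show "M \<subseteq> \<Union>?\<W>" using atom_self by blast
  qed
  have parts: "\<exists>x y. V = atom \<T> x \<union> atom \<T> y \<and>
      (\<forall>u\<in>{x, y}. \<forall>v\<in>{x, y}. close (atom \<T> u) (atom \<T> v))" if memV: "V \<in> \<V>" for V
  proof -
    obtain x y where V: "V = atom \<T> x \<union> atom \<T> y" "close (atom \<T> x) (atom \<T> y)"
      using memV unfolding \<V>_def by blast
    then have "\<forall>u\<in>{x, y}. \<forall>v\<in>{x, y}. close (atom \<T> u) (atom \<T> v)"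
      using close_sym close_imp_self by blast
    then show ?thesis using V by blast
  qed
  have star: "coarse_star T \<V> \<subseteq> coarse_star S \<U>" if TS: "coarsely_in T (coarse_star S \<V>)" for S T
  proof
    fix v assume "v \<in> coarse_star T \<V>"
    then obtain V where V: "V \<in> \<V>" "close T V" "v \<in> V" unfolding coarse_star_def by blast
    have "close (coarse_star S \<V>) V" using close_coarsely_in[OF V(2) TS coarse_star_subset] .
    then have "close V (\<Union>{W\<in>\<V>. close S W})" using close_sym unfolding coarse_star_def by blast
    then obtain W where W: "W \<in> \<V>" "close S W" "close V W"
      using close_UnionD[of V "{W\<in>\<V>. close S W}"] coarse_coverD(1)[OF covV] by auto
    obtain x x' where x: "V = atom \<T> x \<union> atom \<T> x'"
      "\<forall>u\<in>{x, x'}. \<forall>v\<in>{x, x'}. close (atom \<T> u) (atom \<T> v)" using parts[OF V(1)] by blast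
    obtain y y' where y: "W = atom \<T> y \<union> atom \<T> y'"
      "\<forall>u\<in>{y, y'}. \<forall>v\<in>{y, y'}. close (atom \<T> u) (atom \<T> v)" using parts[OF W(1)] by blast
    obtain a where a: "a \<in> {x, x'}" "v \<in> atom \<T> a" using V x by blast
    have "close W (atom \<T> x) \<or> close W (atom \<T> x')"
      using close_sym[OF W(3)] close_Un_iff[OF atom_subset atom_subset] x(1) by blast
    then obtain b where b: "b \<in> {x, x'}" "close (atom \<T> b) W" using close_sym by blast
    obtain c where c: "c \<in> {y, y'}" "close (atom \<T> b) (atom \<T> c)"
      using b(2) y(1) close_Un_iff[OF atom_subset atom_subset] by blast
    obtain e where e: "e \<in> {y, y'}" "close S (atom \<T> e)"
      using W(2) y(1) close_Un_iff[OF atom_subset atom_subset] by blast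
    have "close (atom \<U> a) (atom \<U> e)" using chain[of a b c e] x y a b c e by blast
    then obtain U where U: "U \<in> \<U>" "atom \<U> a \<subseteq> U" "atom \<U> e \<subseteq> U"
      using ex_member_of_close_atoms[OF cov] by blast
    have "close S U"
      using close_mono[OF e(2)] U atom_antimono[OF T(2)] coarse_coverD(2)[OF cov U(1)]
        close_subsetD[OF e(2)] by blast
    moreover have "v \<in> U" using a U atom_antimono[OF T(2)] by blast
    ultimately show "v \<in> coarse_star S \<U>" using U unfolding coarse_star_def by blast
  qed
  have "star_near \<U> S Q" if "star_near \<V> S T" "star_near \<V> T Q" for S T Q
    using that star coarsely_in_mono unfolding star_near_def by blast
  then show ?thesis using that covV by blast
qed

section \<open>Separation\<close>

text \<open>Points \<open>x k\<close> of \<open>S\<close> at distance more than \<open>k\<close> from \<open>T\<close> do it: for each \<open>R\<close> only finitely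
  many of them are within \<open>R\<close> of \<open>T\<close>.\<close>

lemma ex_unbounded_not_close:
  assumes M: "S \<subseteq> M" "T \<subseteq> M" and T: "T \<noteq> {}" and n: "\<not> coarsely_in S T"
  obtains A where "A \<subseteq> S" "\<not> mbounded A" "\<not> close A T"
proof -
  have "\<forall>k::nat. \<exists>x. x \<in> S \<and> (\<forall>y\<in>T. d x y > real k)"
    using n unfolding coarsely_in_def by (meson not_le)
  then obtain x where x: "\<And>k. x k \<in> S" "\<And>k y. y \<in> T \<Longrightarrow> d (x k) y > real k" by metis
  have AM: "range x \<subseteq> M" using x M by blast
  have "\<not> mbounded (range x)"
  proof
    assume b: "mbounded (range x)"
    obtain t where t: "t \<in> T" using T by blast
    then have "mbounded (insert t (range x))" using b M mbounded_insert by blast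
    then obtain r where r: "\<And>k. d (x k) t \<le> r" unfolding mbounded_alt by blast
    obtain k where "real k > r" using reals_Archimedean2 by blast
    then show False using r[of k] x(2)[OF t, of k] by linarith
  qed
  moreover have "mbounded {a\<in>range x. \<exists>b\<in>T. d a b \<le> R}" for R
  proof -
    obtain m where m: "real m > R" using reals_Archimedean2 by blast
    have "{a\<in>range x. \<exists>b\<in>T. d a b \<le> R} \<subseteq> x ` {..<m}"
    proof safe
      fix k b assume "b \<in> T" "d (x k) b \<le> R"
      then have "real k < real m" using x(2)[of b k] m by linarith
      then show "x k \<in> x ` {..<m}" by simp
    qed
    moreover have "mbounded (x ` {..<m})" using AM
      by (intro compactin_imp_mbounded finite_imp_compactin) auto
    ultimately show ?thesis using mbounded_subset by blast
  qed
  then have "\<not> close (range x) T" by (rule not_closeI[OF AM M(2)])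
  ultimately show ?thesis using that[of "range x"] x by blast
qed

lemma mbounded_not_close:
  assumes "mbounded B"
  shows "\<not> close B A"
  using assms close_imp_self close_self_iff mbounded_subset_mspace by blast

text \<open>Besides pairs between \<open>C\<close> and \<open>M - D\<close>, the pairs with a point in \<open>C \<inter> (M - D)\<close> lie in
  no common member; this intersection is bounded, because it would otherwise make \<open>C\<close> and
  \<open>M - D\<close> close.\<close>

lemma coarse_cover_pair:
  assumes C: "C \<subseteq> M" and D: "D \<subseteq> M" and far: "\<not> close C (M - D)"
  shows "coarse_cover {M - C, D}"
proof -
  let ?B = "C \<inter> (M - D)"
  have "\<not> close ?B ?B" using far C close_mono[of ?B ?B C "M - D"] by blast
  then have B: "\<not> close ?B M" "\<not> close M ?B"
    using mbounded_not_close close_self_iff[of ?B] close_sym C by blast+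
  have "coentourage P" if "P \<in> {C \<times> (M - D), (M - D) \<times> C, ?B \<times> M, M \<times> ?B}" for P
    using that far B close_sym[of "M - D" C] C by (auto simp: close_def)
  then have "coentourage (\<Union>{C \<times> (M - D), (M - D) \<times> C, ?B \<times> M, M \<times> ?B})"
    by (intro coentourage_Union) auto
  moreover have "M \<times> M - (\<Union>U\<in>{M - C, D}. U \<times> U) \<subseteq>
      \<Union>{C \<times> (M - D), (M - D) \<times> C, ?B \<times> M, M \<times> ?B}" by auto
  ultimately have "coentourage (M \<times> M - (\<Union>U\<in>{M - C, D}. U \<times> U))"
    by (rule coentourage_subset)
  then show ?thesis using D by (simp add: coarse_cover_def)
qed

text \<open>The set \<open>A\<close> below witnesses that \<open>S\<close> leaves every bounded neighbourhood of \<open>T\<close>.  One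
  interpolating set would give a star of \<open>T\<close> disjoint from \<open>A\<close>; two are taken so that this star
  is not even close to \<open>A\<close>.\<close>

lemma ex_cover_not_star_near:
  assumes M: "S \<subseteq> M" "T \<subseteq> M" and T: "T \<noteq> {}" and n: "\<not> coarsely_in S T"
  obtains \<U> where "coarse_cover \<U>" "\<not> star_near \<U> S T"
proof -
  obtain A where A: "A \<subseteq> S" "\<not> mbounded A" "\<not> close A T"
    using ex_unbounded_not_close[OF M T n] by blast
  have AM: "A \<subseteq> M" using A M by blast
  obtain C2 where C2: "C2 \<subseteq> M" "\<not> close A (M - C2)" "\<not> close C2 T"
    using not_close_interpolate[OF AM M(2) A(3)] by blast
  obtain C1 where C1: "C1 \<subseteq> M" "\<not> close A (M - C1)" "\<not> close C1 (M - C2)"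
    using not_close_interpolate[OF AM _ C2(2)] by blast
  have "coarse_star T {M - C1, C2} \<subseteq> M - C1"
    using C2 close_sym unfolding coarse_star_def by blast
  moreover have "\<not> coarsely_in A (M - C1)"
  proof
    assume "coarsely_in A (M - C1)"
    then have "close (M - C1) A" using close_coarsely_in[of A A] close_self_iff AM A by blast
    then show False using C1 close_sym by blast
  qed
  ultimately have "\<not> star_near {M - C1, C2} S T"
    using A(1) coarsely_in_mono unfolding star_near_def by blast
  then show ?thesis using that coarse_cover_pair C1 C2 by blast
qed

section \<open>Rays and their classes\<close>

lemma coarse_ray_range:
  assumes "\<phi> \<in> coarse_rays"
  shows "range \<phi> \<subseteq> M" "\<not> mbounded (range \<phi>)"
proof -
  interpret N: Metric_space UNIV "\<lambda>m n. \<bar>real m - real n\<bar>" by (rule metric_space_nat)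
  show "range \<phi> \<subseteq> M" using assms by (auto simp: coarse_rays_def N.coarse_map_def)
  show "\<not> mbounded (range \<phi>)"
  proof
    assume "mbounded (range \<phi>)"
    then have "N.mbounded (\<phi> -` range \<phi> \<inter> UNIV)"
      using assms unfolding coarse_rays_def N.coarse_map_def by blast
    then have "N.mbounded UNIV" by (simp add: vimage_def)
    then obtain r where r: "\<And>m n. \<bar>real m - real n\<bar> \<le> r" unfolding N.mbounded_alt by blast
    obtain m where "real m > r" using reals_Archimedean2 by blast
    then show False using r[of m 0] by simp
  qed
qed

lemma endpointsE:
  assumes "p \<in> endpoints"
  obtains \<phi> where "\<phi> \<in> coarse_rays" "p = end_rel `` {\<phi>}"
  using assms unfolding endpoints_def by (auto elim: quotientE)

text \<open>The definition asks for some pair of representatives; any pair can be tested instead,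
  since equivalent rays are within bounded distance and have the same star.\<close>

lemma end_basic_iff:
  assumes cov: "coarse_cover \<U>" and rays: "\<phi> \<in> coarse_rays" "\<psi> \<in> coarse_rays"
  shows "(end_rel `` {\<phi>}, end_rel `` {\<psi>}) \<in> end_basic \<U> \<longleftrightarrow> star_near \<U> (range \<phi>) (range \<psi>)"
    (is "(?p, ?q) \<in> _ \<longleftrightarrow> _")
proof -
  have pq: "?p \<in> endpoints" "?q \<in> endpoints"
    using rays unfolding endpoints_def by (auto intro: quotientI)
  have self: "\<phi> \<in> ?p" "\<psi> \<in> ?q" using rays equiv_end_rel equiv_class_self by metis+
  have ent: "(\<exists>E. entourage E \<and> range \<psi>' \<subseteq> thicken E (coarse_star (range \<phi>') \<U>) \<and>
      range \<phi>' \<subseteq> thicken E (coarse_star (range \<psi>') \<U>)) \<longleftrightarrow> star_near \<U> (range \<phi>') (range \<psi>')"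
    if "\<phi>' \<in> coarse_rays" "\<psi>' \<in> coarse_rays" for \<phi>' \<psi>'
    using ex_entourage_thicken_iff[OF coarse_ray_range(1)[OF that(2)] coarse_star_subset
        coarse_ray_range(1)[OF that(1)] coarse_star_subset]
    unfolding star_near_def by blast
  show ?thesis
  proof
    assume "(?p, ?q) \<in> end_basic \<U>"
    then obtain \<phi>' \<psi>' where mem: "\<phi>' \<in> ?p" "\<psi>' \<in> ?q"
      and E: "\<exists>E. entourage E \<and> range \<psi>' \<subseteq> thicken E (coarse_star (range \<phi>') \<U>) \<and>
        range \<phi>' \<subseteq> thicken E (coarse_star (range \<psi>') \<U>)"
      unfolding end_basic_def end_nbhd_def by blast
    have r: "\<phi>' \<in> coarse_rays" "\<psi>' \<in> coarse_rays"
      and h: "finite_hausdorff_dist (range \<phi>) (range \<phi>')" "finite_hausdorff_dist (range \<psi>) (range \<psi>')"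
      using mem unfolding end_rel_def by auto
    have "star_near \<U> (range \<phi>') (range \<psi>')" using ent[OF r] E by blast
    moreover have "finite_hausdorff_dist (range \<phi>') (range \<phi>)" "finite_hausdorff_dist (range \<psi>') (range \<psi>)"
      using h by (simp_all add: finite_hausdorff_dist_iff)
    ultimately show "star_near \<U> (range \<phi>) (range \<psi>)"
      using star_near_finite_hausdorff_dist coarse_ray_range(1) rays r by meson
  next
    assume "star_near \<U> (range \<phi>) (range \<psi>)"
    then show "(?p, ?q) \<in> end_basic \<U>"
      using ent[OF rays] pq self unfolding end_basic_def end_nbhd_def by blast
  qed
qed

lemma end_basic_subset: "end_basic \<U> \<subseteq> endpoints \<times> endpoints"
  unfolding end_basic_def end_nbhd_def by blast

lemma end_basic_in_uniformity: "coarse_cover \<U> \<Longrightarrow> end_basic \<U> \<in> ends_uniformity"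
  using end_basic_subset unfolding ends_uniformity_def by blast

lemma coarse_cover_whole: "coarse_cover {M}"
  by (simp add: coarse_cover_def coentourage_def)

section \<open>The uniformity on the space of ends\<close>

lemma Id_on_subset_end_basic:
  assumes cov: "coarse_cover \<U>"
  shows "Id_on endpoints \<subseteq> end_basic \<U>"
proof -
  have "(p, p) \<in> end_basic \<U>" if p: "p \<in> endpoints" for p
  proof -
    obtain \<phi> where \<phi>: "\<phi> \<in> coarse_rays" "p = end_rel `` {\<phi>}" using endpointsE[OF p] .
    have "star_near \<U> (range \<phi>) (range \<phi>)"
      using coarse_ray_range[OF \<phi>(1)] by (intro star_near_if_same_members_close[OF cov]) auto
    then show ?thesis using end_basic_iff[OF cov \<phi>(1) \<phi>(1)] \<phi>(2) by simp
  qed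
  then show ?thesis by auto
qed

lemma end_basic_refine:
  assumes "coarse_cover \<U>" "coarse_cover \<V>" "\<And>V. V \<in> \<V> \<Longrightarrow> \<exists>U\<in>\<U>. V \<subseteq> U"
  shows "end_basic \<V> \<subseteq> end_basic \<U>"
proof
  fix z assume z: "z \<in> end_basic \<V>"
  then have "fst z \<in> endpoints" "snd z \<in> endpoints" using end_basic_subset by fastforce+
  then obtain \<phi> \<psi> where "\<phi> \<in> coarse_rays" "\<psi> \<in> coarse_rays" "z = (end_rel `` {\<phi>}, end_rel `` {\<psi>})"
    by (metis endpointsE prod.collapse)
  then show "z \<in> end_basic \<U>"
    using z end_basic_iff assms(1,2) star_near_refine[OF _ assms(3) coarse_coverD(2)[OF assms(1)]]
    by blast
qed

lemma end_basic_converse: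
  assumes "coarse_cover \<U>"
  shows "end_basic \<U> \<subseteq> (end_basic \<U>)\<inverse>"
  unfolding end_basic_def end_nbhd_def by blast

lemma ex_end_basic_relcomp:
  assumes cov: "coarse_cover \<U>"
  obtains \<V> where "coarse_cover \<V>" "end_basic \<V> O end_basic \<V> \<subseteq> end_basic \<U>"
proof -
  obtain \<V> where V: "coarse_cover \<V>"
    "\<And>S T Q. star_near \<V> S T \<Longrightarrow> star_near \<V> T Q \<Longrightarrow> star_near \<U> S Q"
    using ex_cover_star_near_trans[OF cov] by blast
  have "(p, r) \<in> end_basic \<U>" if pq: "(p, q) \<in> end_basic \<V>" and qr: "(q, r) \<in> end_basic \<V>" for p q r
  proof -
    have "p \<in> endpoints" "q \<in> endpoints" "r \<in> endpoints" using pq qr end_basic_subset by blast+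
    then obtain \<phi> \<psi> \<rho> where "\<phi> \<in> coarse_rays" "\<psi> \<in> coarse_rays" "\<rho> \<in> coarse_rays"
      "p = end_rel `` {\<phi>}" "q = end_rel `` {\<psi>}" "r = end_rel `` {\<rho>}" by (metis endpointsE)
    then show ?thesis using pq qr end_basic_iff[OF V(1)] end_basic_iff[OF cov] V(2) by blast
  qed
  then show ?thesis using that V by blast
qed

theorem uniform_space_on_endpoints: "uniform_space_on endpoints ends_uniformity"
  unfolding uniform_space_on_def
proof (intro conjI ballI allI impI)
  show "ends_uniformity \<noteq> {}" using end_basic_in_uniformity coarse_cover_whole by blast
next
  fix D assume "D \<in> ends_uniformity"
  then obtain \<U> where D: "D \<subseteq> endpoints \<times> endpoints" and cov: "coarse_cover \<U>" and sub: "end_basic \<U> \<subseteq> D"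
    unfolding ends_uniformity_def by blast
  show "Id_on endpoints \<subseteq> D" using Id_on_subset_end_basic[OF cov] sub by blast
  show "D \<subseteq> endpoints \<times> endpoints" by (rule D)
  show "D' \<in> ends_uniformity" if "D \<subseteq> D' \<and> D' \<subseteq> endpoints \<times> endpoints" for D'
    using that cov sub unfolding ends_uniformity_def by blast
  show "D\<inverse> \<in> ends_uniformity"
    using D cov sub end_basic_converse[OF cov] unfolding ends_uniformity_def by blast
  show "\<exists>D'\<in>ends_uniformity. D' O D' \<subseteq> D"
  proof -
    obtain \<V> where "coarse_cover \<V>" "end_basic \<V> O end_basic \<V> \<subseteq> end_basic \<U>"
      using ex_end_basic_relcomp[OF cov] .
    then show ?thesis
      using sub by (intro bexI[of _ "end_basic \<V>"] end_basic_in_uniformity) auto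
  qed
  fix D' assume "D' \<in> ends_uniformity"
  then obtain \<V> where cov': "coarse_cover \<V>" and sub': "end_basic \<V> \<subseteq> D'"
    unfolding ends_uniformity_def by blast
  let ?\<W> = "(\<lambda>(U, V). U \<inter> V) ` (\<U> \<times> \<V>)"
  have covW: "coarse_cover ?\<W>" using coarse_cover_Int[OF cov cov'] .
  have "end_basic ?\<W> \<subseteq> end_basic \<U>" using cov covW by (rule end_basic_refine) auto
  moreover have "end_basic ?\<W> \<subseteq> end_basic \<V>" using cov' covW by (rule end_basic_refine) auto
  ultimately have "end_basic ?\<W> \<subseteq> D \<inter> D'" using sub sub' by blast
  then show "D \<inter> D' \<in> ends_uniformity" using covW D unfolding ends_uniformity_def by blast
qed

text \<open>One end is chosen for each of the finitely many sets of members close to a ray.\<close>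

theorem totally_bounded_on_endpoints: "totally_bounded_on endpoints ends_uniformity"
  unfolding totally_bounded_on_def
proof
  fix D assume "D \<in> ends_uniformity"
  then obtain \<U> where cov: "coarse_cover \<U>" and sub: "end_basic \<U> \<subseteq> D"
    unfolding ends_uniformity_def by blast
  let ?t = "\<lambda>\<phi>. {U\<in>\<U>. close (range \<phi>) U}"
  have "finite (?t ` coarse_rays)"
    by (rule finite_subset[of _ "Pow \<U>"]) (use coarse_coverD(1)[OF cov] in auto)
  then obtain R where R: "finite R" "R \<subseteq> coarse_rays" "?t ` coarse_rays = ?t ` R"
    using finite_subset_image[of "?t ` coarse_rays" ?t coarse_rays] by blast
  let ?F = "(\<lambda>\<phi>. end_rel `` {\<phi>}) ` R"
  have "\<exists>p\<in>?F. (p, q) \<in> D" if q: "q \<in> endpoints" for q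
  proof -
    obtain \<psi> where \<psi>: "\<psi> \<in> coarse_rays" "q = end_rel `` {\<psi>}" using endpointsE[OF q] .
    then have "?t \<psi> \<in> ?t ` R" using R(3) by blast
    then obtain \<phi> where \<phi>: "\<phi> \<in> R" "?t \<psi> = ?t \<phi>" by blast
    have \<phi>r: "\<phi> \<in> coarse_rays" using \<phi> R by blast
    have "star_near \<U> (range \<phi>) (range \<psi>)"
      using coarse_ray_range[OF \<phi>r] coarse_ray_range[OF \<psi>(1)] \<phi>(2)
      by (intro star_near_if_same_members_close[OF cov]) auto
    then have "(end_rel `` {\<phi>}, q) \<in> end_basic \<U>" using end_basic_iff[OF cov \<phi>r \<psi>(1)] \<psi>(2) by blast
    then show ?thesis using sub \<phi> by blast
  qed
  moreover have "finite ?F" "?F \<subseteq> endpoints"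
    using R unfolding endpoints_def by (auto intro: quotientI)
  ultimately show "\<exists>F. finite F \<and> F \<subseteq> endpoints \<and> (\<forall>q\<in>endpoints. \<exists>p\<in>F. (p, q) \<in> D)" by blast
qed

theorem separating_on_endpoints: "separating_on endpoints ends_uniformity"
  unfolding separating_on_def
proof
  show "Id_on endpoints \<subseteq> \<Inter>ends_uniformity"
    using uniform_space_on_endpoints unfolding uniform_space_on_def by (intro Inter_greatest) simp
  have "p = q \<and> p \<in> endpoints" if pq: "(p, q) \<in> \<Inter>ends_uniformity" for p q
  proof -
    have b: "(p, q) \<in> end_basic \<U>" if "coarse_cover \<U>" for \<U>
      using pq end_basic_in_uniformity[OF that] by blast
    have ends: "p \<in> endpoints" "q \<in> endpoints"
      using b[OF coarse_cover_whole] end_basic_subset by blast+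
    obtain \<phi> where \<phi>: "\<phi> \<in> coarse_rays" "p = end_rel `` {\<phi>}" using endpointsE[OF ends(1)] .
    obtain \<psi> where \<psi>: "\<psi> \<in> coarse_rays" "q = end_rel `` {\<psi>}" using endpointsE[OF ends(2)] .
    have near: "star_near \<U> (range \<phi>) (range \<psi>)" "star_near \<U> (range \<psi>) (range \<phi>)"
      if "coarse_cover \<U>" for \<U>
      using b[OF that] end_basic_iff[OF that] \<phi> \<psi> unfolding star_near_def by blast+
    have "coarsely_in (range \<alpha>) (range \<beta>)"
      if "\<alpha> \<in> coarse_rays" "\<beta> \<in> coarse_rays"
        and "\<And>\<U>. coarse_cover \<U> \<Longrightarrow> star_near \<U> (range \<alpha>) (range \<beta>)" for \<alpha> \<beta>
      using ex_cover_not_star_near[OF coarse_ray_range(1)[OF that(1)] coarse_ray_range(1)[OF that(2)]]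
        that(3) by (metis UNIV_not_empty image_is_empty)
    then have "coarsely_in (range \<phi>) (range \<psi>)" "coarsely_in (range \<psi>) (range \<phi>)"
      using near \<phi>(1) \<psi>(1) by simp_all
    then have "(\<phi>, \<psi>) \<in> end_rel"
      using \<phi> \<psi> by (simp add: end_rel_def finite_hausdorff_dist_iff)
    then show ?thesis using \<phi>(2) \<psi>(2) ends equiv_class_eq[OF equiv_end_rel] by blast
  qed
  then show "\<Inter>ends_uniformity \<subseteq> Id_on endpoints" by (auto simp: Id_on_iff)
qed

end

theorem theoremB:
  fixes M :: "'a set" and d :: "'a \<Rightarrow> 'a \<Rightarrow> real"
  assumes "Metric_space M d"
  shows "uniform_space_on (Metric_space.endpoints M d) (Metric_space.ends_uniformity M d) \<and>
         totally_bounded_on (Metric_space.endpoints M d) (Metric_space.ends_uniformity M d) \<and>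
         separating_on (Metric_space.endpoints M d) (Metric_space.ends_uniformity M d)"
  using Metric_space.uniform_space_on_endpoints[OF assms]
    Metric_space.totally_bounded_on_endpoints[OF assms]
    Metric_space.separating_on_endpoints[OF assms] by blast

end
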